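(* Let $(s_{1,1},s_{1,2})=\mathcal{N}(\sigma_1,\sigma_2)$ be a Nikishin system of two measures. If $\sigma_1$ satisfies Carleman's condition, then so do $s_{1,2}$ and $\tau_1$, where $\tau_1$ is the inverse measure of $\sigma_1$.
   Context: Measures. For an interval $\Delta\subset\mathbb{R}$, $\mathcal{M}(\Delta)$ is the class of finite Borel measures $s$ of constant (not necessarily positive) sign whose support is an infinite subset of $\mathbb{R}$, with $\Delta=\mathrm{Co}(\mathrm{supp}(s))$ the smallest interval containing $\mathrm{supp}(s)$, and, if the support is unbounded, with $x^n\in L_1(s)$ for all $n\in\mathbb{N}$. The Cauchy transform is $\widehat{s}(z)=\int\frac{ds(x)}{z-x}$. Nikishin system of two measures. Let $\Delta_1,\Delta_2$ be intervals with $\Delta_1\cap\Delta_2$ either empty or a single point $\{x_{1,2}\}$; let $\sigma_j\in\mathcal{M}(\Delta_j)$ with $\mathrm{Co}(\mathrm{supp}(\sigma_j))=\Delta_j$, $j=1,2$, be such that $\widehat{\sigma}_2\in L_1(\sigma_1)$ and the measure $\langle\sigma_1,\sigma_2\rangle$, defined by $d\langle\sigma_1,\sigma_2\rangle(x):=\widehat{\sigma}_2(x)\,d\sigma_1(x)$, belongs to $\mathcal{M}(\Delta_1)$; if $\Delta_1\cap\Delta_2=\{x_{1,2}\}$ assume also that $x_{1,2}$ is not a mass point of $\sigma_1$ or $\sigma_2$. Then $(s_{1,1},s_{1,2})=\mathcal{N}(\sigma_1,\sigma_2)$ means $s_{1,1}=\sigma_1$, $s_{1,2}=\langle\sigma_1,\sigma_2\rangle$.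 Inverse measure. It is known that for each $\sigma\in\mathcal{M}(\Delta)$ with $\Delta$ contained in a half line there exist a measure $\tau\in\mathcal{M}(\Delta)$ and a real polynomial $\ell$ of degree one such that $1/\widehat{\sigma}(z)=\ell(z)+\widehat{\tau}(z)$. The measure $\tau$ is called the inverse measure of $\sigma$; that of $\sigma_1$ is denoted $\tau_1$. Carleman's condition. If $s\in\mathcal{M}(\Delta)$, $\Delta\subset\mathbb{R}_+$, has moments $c_n=\int x^n\,ds(x)$, $s$ satisfies Carleman's condition if $\sum_{n\ge1}|c_n|^{-1/2n}=\infty$ (exponent $-1/(2n)$). If $\Delta$ is contained in a half line, $s$ satisfies Carleman's condition if its image under an affine transformation taking $\Delta$ into $\mathbb{R}_+$ does. *)

theory Defs
  imports "HOL-Analysis.Analysis" "HOL-Computational_Algebra.Polynomial"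
begin

(* A nonzero measure of constant sign is encoded by its sign (1 or -1) and its
   total variation, a positive measure: "CS e M" stands for the measure e M. *)
datatype cs_measure = CS (csign: real) (cabs: "real measure")

definition cs_value :: "cs_measure \<Rightarrow> real set \<Rightarrow> real" where
  "cs_value s A = csign s * measure (cabs s) A"

definition cs_integral ::
    "cs_measure \<Rightarrow> (real \<Rightarrow> 'a::{banach, second_countable_topology}) \<Rightarrow> 'a" where
  "cs_integral s f = csign s *\<^sub>R (LINT x|cabs s. f x)"

definition supp :: "cs_measure \<Rightarrow> real set" where
  "supp s = {x. \<forall>U. open U \<and> x \<in> U \<longrightarrow> emeasure (cabs s) U \<noteq> 0}"

definition Co_supp :: "cs_measure \<Rightarrow> real set" where
  "Co_supp s = convex hull (supp s)"

definition cs_measures :: "real set \<Rightarrow> cs_measure set" where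
  "cs_measures \<Delta> = {s. csign s \<in> {1, -1} \<and> sets (cabs s) = sets borel \<and>
     finite_measure (cabs s) \<and> infinite (supp s) \<and> Co_supp s = \<Delta> \<and>
     (\<not> bounded (supp s) \<longrightarrow> (\<forall>n::nat. integrable (cabs s) (\<lambda>x. x ^ n)))}"

(* Used both at complex points and, to form the measure <sigma1, sigma2>, at real ones. *)
definition cauchy_transform ::
    "cs_measure \<Rightarrow> 'a \<Rightarrow> 'a::{real_normed_field, banach, second_countable_topology}" where
  "cauchy_transform s z = cs_integral s (\<lambda>x. 1 / (z - of_real x))"

(* s = <s1, s2>, i.e. ds(x) = (cauchy_transform s2 x) ds1(x). A relation, since the
   right-hand side is representable as a cs_measure only if it has constant sign. *)
definition is_bracket :: "cs_measure \<Rightarrow> cs_measure \<Rightarrow> cs_measure \<Rightarrow> bool" where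
  "is_bracket s1 s2 s \<longleftrightarrow>
     (\<forall>A\<in>sets borel. cs_value s A = cs_integral s1 (\<lambda>x. indicator A x * cauchy_transform s2 x))"

definition nikishin ::
    "real set \<Rightarrow> real set \<Rightarrow> cs_measure \<Rightarrow> cs_measure \<Rightarrow> cs_measure \<times> cs_measure \<Rightarrow> bool" where
  "nikishin \<Delta>1 \<Delta>2 \<sigma>1 \<sigma>2 S \<longleftrightarrow>
     \<sigma>1 \<in> cs_measures \<Delta>1 \<and> \<sigma>2 \<in> cs_measures \<Delta>2 \<and>
     (\<Delta>1 \<inter> \<Delta>2 = {} \<or>
       (\<exists>x. \<Delta>1 \<inter> \<Delta>2 = {x} \<and> cs_value \<sigma>1 {x} = 0 \<and> cs_value \<sigma>2 {x} = 0)) \<and>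
     integrable (cabs \<sigma>1) (\<lambda>x. cauchy_transform \<sigma>2 x) \<and>
     fst S = \<sigma>1 \<and>
     is_bracket \<sigma>1 \<sigma>2 (snd S) \<and> snd S \<in> cs_measures \<Delta>1"

(* The convex hull of the support of tau may be strictly smaller than \<Delta>: this happens
   when sigma has an isolated mass at an end point of \<Delta>. *)
definition is_inverse_measure :: "real set \<Rightarrow> cs_measure \<Rightarrow> cs_measure \<Rightarrow> bool" where
  "is_inverse_measure \<Delta> \<sigma> \<tau> \<longleftrightarrow>
     \<sigma> \<in> cs_measures \<Delta> \<and> (\<exists>\<Delta>'. \<Delta>' \<subseteq> \<Delta> \<and> \<tau> \<in> cs_measures \<Delta>') \<and>
     (\<exists>l::real poly. degree l = 1 \<and>
       (\<forall>z::complex. z \<notin> of_real ` \<Delta> \<longrightarrow>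
          1 / cauchy_transform \<sigma> z = poly (map_poly of_real l) z + cauchy_transform \<tau> z))"

definition moment :: "cs_measure \<Rightarrow> nat \<Rightarrow> real" where
  "moment s n = cs_integral s (\<lambda>x. x ^ n)"

(* Divergence of the series over n >= 1; the index is shifted by one. *)
definition carleman_series_diverges :: "cs_measure \<Rightarrow> bool" where
  "carleman_series_diverges s \<longleftrightarrow>
     \<not> summable (\<lambda>n. \<bar>moment s (Suc n)\<bar> powr (- 1 / (2 * real (Suc n))))"

definition affine_image :: "real \<Rightarrow> real \<Rightarrow> cs_measure \<Rightarrow> cs_measure" where
  "affine_image a b s = CS (csign s) (distr (cabs s) borel (\<lambda>x. a * x + b))"

(* Whether the series diverges does not depend on the choice of a and b; a = 1, b = 0 is
   the condition for measures supported in the nonnegative half line. *)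
definition carleman :: "cs_measure \<Rightarrow> bool" where
  "carleman s \<longleftrightarrow>
     (\<exists>a b. a \<noteq> 0 \<and> (\<lambda>x. a * x + b) ` Co_supp s \<subseteq> {0..} \<and>
        carleman_series_diverges (affine_image a b s))"

end

theory Submission
  imports Defs "HOL-Library.Landau_Symbols"
begin

text \<open>
  Fix the affine map \<open>x \<mapsto> a * x + b\<close> that exhibits Carleman's condition for \<open>\<sigma>1\<close>. All three
  measures live on \<open>\<Delta>1\<close>, so the same map carries their total variations to measures on
  \<open>[0, \<infinity>)\<close>, and everything is a comparison of the moments \<open>c\<close> of \<open>\<sigma>1\<close> with the moments
  \<open>d\<close> of the other measure. Carleman's condition passes from \<open>c\<close> to \<open>d\<close> as soon as
  \<open>d n \<le> K * (B ^ n + c (n + k))\<close> for constants \<open>K\<close>, \<open>B\<close>, \<open>k\<close>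
  (\<open>carleman_sum_diverges_transfer\<close>): the moments \<open>c n\<close> are bounded below by a geometric
  sequence, a geometric factor only changes the terms of the series by a bounded factor, and
  an index shift only loses a convergent series.

  For \<open>s12\<close>, a point \<open>p\<close> separates \<open>\<Delta>1\<close> from \<open>\<Delta>2\<close>. At distance at least \<open>1\<close> from
  \<open>p\<close> the density, up to sign the Cauchy transform of \<open>\<sigma>2\<close>, is bounded on \<open>\<Delta>1\<close> and contributes a
  multiple of \<open>c n\<close>; near \<open>p\<close> the density is integrable and \<open>a * x + b\<close> is bounded, which
  contributes a multiple of \<open>B ^ n\<close> (\<open>bracket_moment_bound\<close>).

  For the inverse measure, the product of the transform of \<open>\<sigma>1\<close> with the sum of \<open>l\<close> and the
  transform of \<open>\<tau>1\<close> is \<open>1\<close>. Comparing the coefficients of the asymptotic expansions at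
  infinity along the negative half line gives
  \<open>\<kappa> * (\<Sum>j\<le>n. c j * d (n - j)) = \<beta> * c (n + 1) - \<alpha> * c (n + 2)\<close> with \<open>\<kappa> \<noteq> 0\<close>. All
  moments are nonnegative, so the summand \<open>c 0 * d n\<close> alone obeys the bound
  (\<open>stieltjes_reciprocal_moment_bound\<close>), and \<open>c (n + 1) \<le> c 0 + c (n + 2)\<close>.
\<close>

section \<open>Divergence of Carleman series\<close>

text \<open>
  For \<open>m \<ge> 1\<close>, the bound makes \<open>v = c (m + k) powr (- 1 / (2 * m))\<close> at most
  \<open>(C * D) powr (1 / 2)\<close> times the \<open>m\<close>-th term of the series of \<open>d\<close>.
  The exponent in \<open>v\<close> has the wrong index. If \<open>u\<close> is the term of index \<open>m + k\<close> of the
  series of \<open>c\<close>, then \<open>v = u * u powr (k / m)\<close>: either \<open>u \<le> (1 / 2) ^ (m + k)\<close>, and these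
  terms form a convergent series, or \<open>u powr (k / m)\<close> is bounded below.
\<close>

lemma carleman_series_shift:
  fixes c d :: "nat \<Rightarrow> real"
  assumes c_pos: "\<And>n. 0 < c n" and d_pos: "\<And>n. 0 < d n"
    and CD: "1 \<le> C" "1 \<le> D"
    and bound: "\<And>n. d n \<le> C * D ^ n * c (n + k)"
    and summable_d: "summable (\<lambda>n. d (Suc n) powr (- 1 / (2 * real (Suc n))))"
  shows "summable (\<lambda>n. c (Suc n) powr (- 1 / (2 * real (Suc n))))"
proof -
  define v where "v n = c (Suc n + k) powr (- 1 / (2 * real (Suc n)))" for n
  define u where "u n = c (Suc n) powr (- 1 / (2 * real (Suc n)))" for n
  have v_le: "(C * D) powr (- 1 / 2) * v n \<le> d (Suc n) powr (- 1 / (2 * real (Suc n)))" for n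
  proof -
    let ?m = "real (Suc n)"
    let ?e = "- 1 / (2 * ?m)"
    have m: "?m \<ge> 1" by simp
    have "C powr (- 1 / 2) \<le> C powr ?e"
      using CD m by (intro powr_mono) (auto simp: field_simps)
    moreover have "(D ^ Suc n) powr ?e = D powr (- 1 / 2)"
    proof -
      have "D ^ Suc n = D powr ?m"
        using CD by (subst powr_realpow) auto
      moreover have "?m * ?e = - 1 / 2"
        using m by (simp del: of_nat_Suc)
      ultimately show ?thesis
        by (simp only: powr_powr)
    qed
    ultimately have "(C * D) powr (- 1 / 2) * v n \<le> C powr ?e * (D ^ Suc n) powr ?e * v n"
      using CD by (auto simp: powr_mult v_def intro!: mult_right_mono)
    also have "\<dots> = (C * D ^ Suc n * c (Suc n + k)) powr ?e"
      using CD c_pos[of "Suc n + k"] by (simp add: powr_mult v_def)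
    also have "\<dots> \<le> d (Suc n) powr ?e"
      using bound[of "Suc n"] d_pos[of "Suc n"] m by (intro powr_mono2') auto
    finally show ?thesis .
  qed
  have "summable (\<lambda>n. (C * D) powr (- 1 / 2) * v n)"
    by (rule summable_comparison_test'[OF summable_d, of 0]) (use v_le in \<open>auto simp: v_def\<close>)
  then have summable_v: "summable v"
    using CD by (subst (asm) summable_cmult_iff) auto
  have u_le: "u (n + k) \<le> (1 / 2) ^ n + 2 powr (real k * (real k + 1)) * v n" for n
  proof (cases "u (n + k) \<le> (1 / 2) ^ (Suc n + k)")
    case True
    also have "(1 / 2 :: real) ^ (Suc n + k) \<le> (1 / 2) ^ n"
      by (intro power_decreasing) auto
    finally show ?thesis
      by (smt (verit) powr_ge_zero v_def mult_nonneg_nonneg)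
  next
    case False
    let ?m = "real (Suc n)"
    let ?N = "real (Suc n + k)"
    have m: "?m \<ge> 1" by simp
    have u_pos: "u (n + k) > 0"
      using c_pos[of "Suc (n + k)"] by (simp add: u_def)
    have "- 1 / (2 * y) * (y / x) = - 1 / (2 * x)" if "0 < x" "0 < y" for x y :: real
      using that by (simp add: field_simps)
    from this[of ?m ?N] have "v n = u (n + k) powr (?N / ?m)"
      by (simp add: v_def u_def powr_powr del: of_nat_Suc)
    also have "?N / ?m = 1 + real k / ?m"
      by (simp add: field_simps)
    also have "u (n + k) powr (1 + real k / ?m) = u (n + k) * u (n + k) powr (real k / ?m)"
      using u_pos by (simp add: powr_add)
    finally have v_eq: "v n = u (n + k) * u (n + k) powr (real k / ?m)" .
    have half: "(1 / 2 :: real) ^ (Suc n + k) = 2 powr (- ?N)"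
      by (simp only: powr_minus powr_realpow power_one_over) (simp add: field_simps)
    have "?N * (real k / ?m) \<le> real k * (real k + 1)"
    proof -
      have "?N / ?m \<le> real k + 1"
        by (simp add: field_simps)
      then have "real k * (?N / ?m) \<le> real k * (real k + 1)"
        by (intro mult_left_mono) auto
      then show ?thesis by (simp add: mult.commute)
    qed
    then have "2 powr (- (real k * (real k + 1))) \<le> 2 powr (- (?N * (real k / ?m)))"
      by (intro powr_mono) (simp_all only: neg_le_iff_le one_le_numeral)
    also have "\<dots> = (2 powr (- ?N)) powr (real k / ?m)"
      by (simp only: powr_powr mult_minus_left)
    also have "\<dots> \<le> u (n + k) powr (real k / ?m)"
      using False half by (intro powr_mono2) auto
    finally have "u (n + k) * 2 powr (- (real k * (real k + 1))) \<le> v n"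
      unfolding v_eq using u_pos by (intro mult_left_mono) auto
    then have "u (n + k) \<le> 2 powr (real k * (real k + 1)) * v n"
      by (simp add: powr_minus_divide pos_divide_le_eq mult.commute)
    then show ?thesis
      by (smt (verit) zero_le_power zero_le_divide_1_iff)
  qed
  have "summable (\<lambda>n. (1 / 2) ^ n + 2 powr (real k * (real k + 1)) * v n)"
    using summable_v by (intro summable_add summable_mult) auto
  then have "summable (\<lambda>n. u (n + k))"
    by (rule summable_comparison_test'[of _ 0]) (use u_le in \<open>auto simp: u_def\<close>)
  then have "summable u"
    by (simp only: summable_iff_shift)
  then show ?thesis
    by (simp only: u_def[abs_def])
qed

section \<open>Measures on the half line with finite moments\<close>

definition power_moment :: "real measure \<Rightarrow> nat \<Rightarrow> real" where
  "power_moment M n = (LINT x|M. x ^ n)"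

text \<open>
  The Stieltjes transform \<open>\<integral> 1 / (t + x) dM(x)\<close> in the variable \<open>s = 1 / t\<close> and multiplied by
  \<open>t\<close>: its asymptotic expansion at infinity becomes a Taylor expansion at \<open>0\<close>.
\<close>

definition stieltjes_series :: "real measure \<Rightarrow> real \<Rightarrow> real" where
  "stieltjes_series M s = (LINT x|M. 1 / (1 + s * x))"

text \<open>
  The last axiom, that \<open>M\<close> is not concentrated at \<open>0\<close>, makes all moments positive. Otherwise
  the terms of the Carleman series would take the default value \<open>0 powr a = 0\<close> where
  the mathematical value is infinite.
\<close>

locale half_line_measure = finite_measure M for M :: "real measure" +
  assumes sets_eq [measurable_cong]: "sets M = sets borel"
    and AE_nonneg: "AE x in M. 0 \<le> x"
    and integrable_power: "integrable M (\<lambda>x. x ^ n)"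
    and positive_mass: "\<exists>r>0. 0 < measure M {r..}"
begin

lemma power_moment_nonneg: "0 \<le> power_moment M n"
  unfolding power_moment_def using AE_nonneg by (intro integral_nonneg_AE) auto

lemma power_moment_ge_geometric:
  obtains r \<delta> where "0 < r" "0 < \<delta>" "\<And>n. \<delta> * r ^ n \<le> power_moment M n"
proof -
  obtain r where r: "0 < r" "0 < measure M {r..}"
    using positive_mass by auto
  have "measure M {r..} * r ^ n \<le> power_moment M n" for n
  proof -
    have "measure M {r..} * r ^ n = (LINT x|M. indicator {r..} x * r ^ n)"
      by (simp add: sets_eq)
    also have "\<dots> \<le> (LINT x|M. x ^ n)"
    proof (rule integral_mono_AE)
      show "AE x in M. indicator {r..} x * r ^ n \<le> x ^ n"
        using AE_nonneg
      proof eventually_elim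
        case (elim x)
        then show ?case
          using r by (cases "r \<le> x") (auto intro: power_mono)
      qed
    qed (auto simp: integrable_power sets_eq less_top[symmetric])
    finally show ?thesis unfolding power_moment_def .
  qed
  with r show thesis by (rule that)
qed

lemma power_moment_pos: "0 < power_moment M n"
proof -
  obtain r \<delta> where "0 < r" "0 < \<delta>" "\<delta> * r ^ n \<le> power_moment M n"
    using power_moment_ge_geometric by metis
  then show ?thesis
    by (smt (verit) mult_pos_pos zero_less_power)
qed

lemma power_moment_Suc_le: "power_moment M (Suc n) \<le> power_moment M 0 + power_moment M (n + 2)"
proof -
  have "power_moment M (Suc n) \<le> (LINT x|M. x ^ 0 + x ^ (n + 2))"
    unfolding power_moment_def
  proof (rule integral_mono_AE)
    show "AE x in M. x ^ Suc n \<le> x ^ 0 + x ^ (n + 2)"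
      using AE_nonneg
    proof eventually_elim
      case (elim x)
      show ?case
      proof (cases "x \<le> 1")
        case True
        with elim have "x ^ Suc n \<le> 1" by (intro power_le_one) auto
        with elim show ?thesis by (simp add: add_increasing2)
      next
        case False
        then have "x ^ Suc n \<le> x ^ (n + 2)" by (intro power_increasing) auto
        then show ?thesis by simp
      qed
    qed
  qed (use integrable_power[of 0] integrable_power[of "Suc n"] integrable_power[of "n + 2"] in auto)
  also have "\<dots> = power_moment M 0 + power_moment M (n + 2)"
    unfolding power_moment_def using integrable_power[of 0] integrable_power[of "n+2"]
    by (subst Bochner_Integration.integral_add) auto
  finally show ?thesis .
qed

lemma integrable_stieltjes_kernel:
  assumes "0 \<le> s"
  shows "integrable M (\<lambda>x. 1 / (1 + s * x))"
proof (rule integrable_const_bound[where B = 1])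
  show "AE x in M. norm (1 / (1 + s * x)) \<le> 1"
    using AE_nonneg
  proof eventually_elim
    case (elim x)
    then have "0 \<le> s * x"
      using assms by simp
    then show ?case
      by (simp add: field_simps)
  qed
qed measurable

lemma stieltjes_series_pos:
  assumes "0 \<le> s"
  shows "0 < stieltjes_series M s"
proof -
  have pos: "0 < 1 / (1 + s * x)" if "0 \<le> x" for x
    using assms that by (simp add: add_pos_nonneg)
  have "(LINT x|M. 0) < (LINT x|M. 1 / (1 + s * x))"
  proof (rule integral_less_AE_space)
    show "integrable M (\<lambda>x. 1 / (1 + s * x))"
      using assms by (rule integrable_stieltjes_kernel)
    show "AE x in M. 0 < 1 / (1 + s * x)"
      using AE_nonneg by eventually_elim (rule pos)
    show "emeasure M (space M) \<noteq> 0"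
      using power_moment_pos[of 0] by (simp add: power_moment_def emeasure_eq_measure)
  qed simp
  then show ?thesis
    by (simp add: stieltjes_series_def)
qed

text \<open>
  Cut the geometric series of \<open>1 / (1 + s * x)\<close> at order \<open>N\<close>. For \<open>s > 0\<close> and \<open>x \<ge> 0\<close> the
  remainder is at most \<open>(s * x) ^ N\<close>, whose integral is finite; this holds even when the
  full moment series converges nowhere.
\<close>

lemma stieltjes_series_expansion:
  "(\<lambda>s. stieltjes_series M s - poly (\<Sum>j<N. monom ((- 1) ^ j * power_moment M j) j) s)
     \<in> O[at_right 0](\<lambda>s. s ^ N)"
proof (rule bigoI[where c = "power_moment M N"])
  have "\<bar>stieltjes_series M s - poly (\<Sum>j<N. monom ((- 1) ^ j * power_moment M j) j) s\<bar>
          \<le> power_moment M N * s ^ N" if s: "s > 0" for s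
  proof -
    have int: "integrable M (\<lambda>x. 1 / (1 + s * x))"
      using s by (intro integrable_stieltjes_kernel) simp
    let ?P = "\<lambda>x. \<Sum>j<N. ((- 1) ^ j * s ^ j) * x ^ j"
    have intP: "integrable M ?P"
      by (intro Bochner_Integration.integrable_sum integrable_mult_right integrable_power)
    have "poly (\<Sum>j<N. monom ((- 1) ^ j * power_moment M j) j) s = (LINT x|M. ?P x)"
      using integrable_power
      by (subst Bochner_Integration.integral_sum)
         (auto simp: poly_sum poly_monom power_moment_def mult_ac)
    then have "stieltjes_series M s - poly (\<Sum>j<N. monom ((- 1) ^ j * power_moment M j) j) s
        = (LINT x|M. 1 / (1 + s * x) - ?P x)"
      using int intP by (simp add: stieltjes_series_def)
    then have "\<bar>stieltjes_series M s - poly (\<Sum>j<N. monom ((- 1) ^ j * power_moment M j) j) s\<bar>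
        \<le> (LINT x|M. \<bar>1 / (1 + s * x) - ?P x\<bar>)"
      by (simp only: integral_abs_bound)
    also have "\<dots> \<le> (LINT x|M. s ^ N * x ^ N)"
    proof (rule integral_mono_AE)
      show "AE x in M. \<bar>1 / (1 + s * x) - ?P x\<bar> \<le> s ^ N * x ^ N"
        using AE_nonneg
      proof eventually_elim
        case (elim x)
        then have sx: "0 \<le> s * x" using s by simp
        have "?P x = (\<Sum>j<N. (- (s * x)) ^ j)"
          by (intro sum.cong refl) (simp add: power_minus[of "s * x"] power_mult_distrib)
        also have "\<dots> = (1 - (- (s * x)) ^ N) / (1 + s * x)"
          using sx by (subst geometric_sum) (auto simp: field_simps)
        finally have "1 / (1 + s * x) - ?P x = (- (s * x)) ^ N / (1 + s * x)"
          by (simp add: diff_divide_distrib)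
        then have "\<bar>1 / (1 + s * x) - ?P x\<bar> = (s * x) ^ N / (1 + s * x)"
          using sx by (simp add: abs_divide power_abs)
        also have "\<dots> \<le> (s * x) ^ N / 1"
          using sx by (intro divide_left_mono) auto
        finally show ?case by (simp add: power_mult_distrib)
      qed
    qed (use int intP integrable_power in auto)
    finally show ?thesis
      by (simp add: power_moment_def mult.commute)
  qed
  then show "\<forall>\<^sub>F s in at_right 0.
      norm (stieltjes_series M s - poly (\<Sum>j<N. monom ((- 1) ^ j * power_moment M j) j) s)
        \<le> power_moment M N * norm (s ^ N)"
    by (auto simp: eventually_at_right_less eventually_at_filter)
qed

end

definition carleman_sum_diverges :: "real measure \<Rightarrow> bool" where
  "carleman_sum_diverges M \<longleftrightarrow>
     \<not> summable (\<lambda>n. power_moment M (Suc n) powr (- 1 / (2 * real (Suc n))))"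

text \<open>
  Because \<open>c n \<ge> \<delta> * r ^ n\<close>, the summand \<open>B ^ n\<close> is absorbed by \<open>c (n + k)\<close> at the cost of a
  geometric factor.
\<close>

lemma carleman_sum_diverges_transfer:
  assumes M: "half_line_measure M" and N: "half_line_measure N"
    and div: "carleman_sum_diverges M"
    and K: "0 \<le> K" and B: "0 \<le> B"
    and bound: "\<And>n. power_moment N n \<le> K * (B ^ n + power_moment M (n + k))"
  shows "carleman_sum_diverges N"
proof -
  interpret M: half_line_measure M by fact
  interpret N: half_line_measure N by fact
  obtain r \<delta> where r: "0 < r" "0 < \<delta>" "\<And>n. \<delta> * r ^ n \<le> power_moment M n"
    using M.power_moment_ge_geometric by metis
  define E where "E = 1 / (\<delta> * r ^ k)"
  define D where "D = max 1 (B / r)"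
  define C where "C = max 1 (K * (E + 1))"
  have E: "0 < E" using r by (simp add: E_def)
  have "power_moment N n \<le> C * D ^ n * power_moment M (n + k)" for n
  proof -
    let ?c = "power_moment M (n + k)"
    have c: "0 \<le> ?c" by (rule M.power_moment_nonneg)
    have Dn: "1 \<le> D ^ n" by (simp add: D_def)
    have "1 = E * (\<delta> * r ^ k)" using r by (simp add: E_def)
    then have "B ^ n = (B / r) ^ n * E * (\<delta> * r ^ (n + k))"
      using r by (simp add: power_divide power_add)
    also have "\<dots> \<le> (B / r) ^ n * E * ?c"
      using r B E by (intro mult_left_mono) auto
    also have "\<dots> \<le> D ^ n * E * ?c"
      using r B E c by (intro mult_right_mono power_mono) (auto simp: D_def)
    finally have "B ^ n + ?c \<le> D ^ n * E * ?c + D ^ n * ?c"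
      using mult_right_mono[OF Dn c] by simp
    then have "K * (B ^ n + ?c) \<le> K * (D ^ n * E * ?c + D ^ n * ?c)"
      using K by (rule mult_left_mono)
    also have "\<dots> = K * (E + 1) * (D ^ n * ?c)"
      by (simp add: algebra_simps)
    also have "\<dots> \<le> C * (D ^ n * ?c)"
      using c Dn by (intro mult_right_mono) (auto simp: C_def)
    finally show ?thesis
      using bound[of n] by (simp add: mult.assoc)
  qed
  then show ?thesis
    using div carleman_series_shift[of "power_moment M" "power_moment N" C D k]
      M.power_moment_pos N.power_moment_pos
    by (auto simp: carleman_sum_diverges_def C_def D_def)
qed

section \<open>Moments and reciprocals of transforms\<close>

text \<open>
  Uniqueness of asymptotic expansions at \<open>0\<close>: letting \<open>s\<close> tend to \<open>0\<close> kills the constant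
  coefficient, and division by \<open>s\<close> lowers the order by one.
\<close>

lemma poly_bigo_power_imp_coeff_eq_0:
  fixes p :: "real poly"
  assumes "poly p \<in> O[at_right 0](\<lambda>s. s ^ N)" and "i < N"
  shows "coeff p i = 0"
  using assms
proof (induction N arbitrary: p i)
  case (Suc N)
  have "(\<lambda>s. s ^ Suc N :: real) \<in> o[at_right 0](\<lambda>_. 1)"
  proof (rule smalloI_tendsto)
    show "((\<lambda>s. s ^ Suc N / 1 :: real) \<longlongrightarrow> 0) (at_right 0)"
      by (auto intro!: tendsto_eq_intros)
  qed auto
  with Suc.prems(1) have "poly p \<in> o[at_right 0](\<lambda>_. 1)"
    by (rule landau_o.big_small_trans)
  then have "(poly p \<longlongrightarrow> 0) (at_right 0)"
    by (auto dest: smalloD_tendsto)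
  moreover have "(poly p \<longlongrightarrow> poly p 0) (at_right 0)"
    by (auto intro!: tendsto_eq_intros)
  ultimately have "poly p 0 = 0"
    using tendsto_unique trivial_limit_at_right_real by blast
  then obtain q where q: "p = pCons 0 q"
    by (metis coeff_pCons_0 pCons_cases poly_0_coeff_0)
  have "(\<lambda>s. s * poly q s) \<in> O[at_right 0](\<lambda>s. s * s ^ N)"
    using Suc.prems(1) by (simp add: q)
  then have "poly q \<in> O[at_right 0](\<lambda>s. s ^ N)"
    by (subst (asm) landau_o.big.mult_cancel_left)
       (auto simp: eventually_at_filter intro: bigthetaI_cong)
  with Suc.IH Suc.prems(2) show ?case
    by (cases i) (auto simp: q)
next
  case 0
  from 0(2) show ?case by simp
qed

text \<open>
  Up to \<open>O(s ^ (n + 3))\<close> the two transforms may be replaced by their Taylor polynomials, so the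
  coefficient of \<open>s ^ (n + 2)\<close> in the product vanishes. All terms of the convolution of
  the moments that appears there carry the same sign \<open>(- 1) ^ n\<close>, so that nothing
  cancels and each one is bounded by the whole sum.
\<close>

lemma stieltjes_reciprocal_moment_bound:
  assumes M: "half_line_measure M" and N: "half_line_measure N"
    and recip: "\<And>s. 0 < s \<Longrightarrow>
       stieltjes_series M s * (\<alpha> + \<beta> * s + \<kappa> * s\<^sup>2 * stieltjes_series N s) = 1"
  shows "\<bar>\<kappa>\<bar> * power_moment M 0 * power_moment N n
    \<le> \<bar>\<alpha>\<bar> * power_moment M (n + 2) + \<bar>\<beta>\<bar> * power_moment M (n + 1)"
proof -
  interpret M: half_line_measure M by fact
  interpret N: half_line_measure N by fact
  define P where "P = (\<Sum>j<n + 3. monom ((- 1) ^ j * power_moment M j) j)"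
  define Q where "Q = (\<Sum>j<n + 3. monom ((- 1) ^ j * power_moment N j) j)"
  define L where "L = [:\<alpha>, \<beta>:] + monom \<kappa> 2 * Q"
  let ?f = "stieltjes_series M" and ?g = "stieltjes_series N"
  let ?h = "\<lambda>s. \<alpha> + \<beta> * s + \<kappa> * s\<^sup>2 * ?g s"
  let ?O = "O[at_right 0](\<lambda>s::real. s ^ (n + 3))"
  have coeff_P: "coeff P j = (- 1) ^ j * power_moment M j" if "j < n + 3" for j
    using that by (simp add: P_def coeff_sum)
  have coeff_Q: "coeff Q j = (- 1) ^ j * power_moment N j" if "j < n + 3" for j
    using that by (simp add: Q_def coeff_sum)
  have bounded_poly: "poly p \<in> O[at_right 0](\<lambda>_. 1)" for p :: "real poly"
  proof (rule bigoI_tendsto)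
    show "((\<lambda>s. poly p s / 1) \<longlongrightarrow> poly p 0) (at_right 0)"
      by (auto intro!: tendsto_eq_intros)
  qed auto
  have power_bounded: "(\<lambda>s::real. s ^ (n + 3)) \<in> O[at_right 0](\<lambda>_. 1)"
  proof -
    have "(\<lambda>s::real. s ^ (n + 3)) = poly (monom 1 (n + 3))"
      by (simp add: poly_monom fun_eq_iff)
    then show ?thesis
      using bounded_poly by simp
  qed
  have f_P: "(\<lambda>s. ?f s - poly P s) \<in> ?O"
    unfolding P_def by (rule M.stieltjes_series_expansion)
  have "(\<lambda>s. (?f s - poly P s) + poly P s) \<in> O[at_right 0](\<lambda>_. 1)"
    by (intro sum_in_bigo bounded_poly landau_o.big_trans[OF f_P power_bounded])
  then have f_bounded: "?f \<in> O[at_right 0](\<lambda>_. 1)"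
    by simp
  have g_Q: "(\<lambda>s. ?g s - poly Q s) \<in> ?O"
    unfolding Q_def by (rule N.stieltjes_series_expansion)
  have "(\<lambda>s. poly (monom \<kappa> 2) s * (?g s - poly Q s)) \<in> O[at_right 0](\<lambda>s. 1 * s ^ (n + 3))"
    by (intro landau_o.big.mult bounded_poly g_Q)
  moreover have "(\<lambda>s. poly (monom \<kappa> 2) s * (?g s - poly Q s)) = (\<lambda>s. ?h s - poly L s)"
    by (simp add: L_def poly_monom algebra_simps fun_eq_iff)
  ultimately have h_L: "(\<lambda>s. ?h s - poly L s) \<in> ?O"
    by simp
  have "(\<lambda>s. (?f s - poly P s) * poly L s) \<in> O[at_right 0](\<lambda>s. s ^ (n + 3) * 1)"
    by (intro landau_o.big.mult bounded_poly f_P)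
  moreover have "(\<lambda>s. ?f s * (?h s - poly L s)) \<in> O[at_right 0](\<lambda>s. 1 * s ^ (n + 3))"
    by (intro landau_o.big.mult f_bounded h_L)
  ultimately have "(\<lambda>s. - ((?f s - poly P s) * poly L s) - ?f s * (?h s - poly L s)) \<in> ?O"
    by (intro sum_in_bigo) simp_all
  moreover have "\<forall>\<^sub>F s in at_right 0.
      - ((?f s - poly P s) * poly L s) - ?f s * (?h s - poly L s) = poly (P * L - 1) s"
    using eventually_at_right_less[of "0::real"]
  proof eventually_elim
    case (elim s)
    then show ?case
      using recip[of s] by (simp add: algebra_simps)
  qed
  ultimately have "poly (P * L - 1) \<in> ?O"
    by (subst (asm) landau_o.big.in_cong)
  then have "coeff (P * L - 1) (n + 2) = 0"
    by (rule poly_bigo_power_imp_coeff_eq_0) simp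
  then have "coeff (P * L) (n + 2) = 0"
    by (simp add: one_pCons)
  moreover have "P * L = smult \<alpha> P + pCons 0 (smult \<beta> P) + monom \<kappa> 2 * (P * Q)"
    by (simp add: L_def algebra_simps)
  then have "coeff (P * L) (n + 2)
      = \<alpha> * coeff P (n + 2) + \<beta> * coeff P (n + 1) + \<kappa> * coeff (P * Q) n"
    by (simp add: coeff_monom_mult)
  moreover have "coeff (P * Q) n
      = (- 1) ^ n * (\<Sum>j\<le>n. power_moment M j * power_moment N (n - j))"
    unfolding coeff_mult sum_distrib_left
  proof (rule sum.cong)
    fix j assume "j \<in> {..n}"
    moreover from this have "(- 1 :: real) ^ j * (- 1) ^ (n - j) = (- 1) ^ n"
      by (simp flip: power_add)
    ultimately show "coeff P j * coeff Q (n - j)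
        = (- 1) ^ n * (power_moment M j * power_moment N (n - j))"
      by (simp add: coeff_P coeff_Q)
  qed simp
  ultimately have "(- 1) ^ n * (\<alpha> * power_moment M (n + 2) - \<beta> * power_moment M (n + 1)
      + \<kappa> * (\<Sum>j\<le>n. power_moment M j * power_moment N (n - j))) = 0"
    using coeff_P[of "n + 1"] coeff_P[of "n + 2"]
    by (simp add: algebra_simps)
  then have "\<kappa> * (\<Sum>j\<le>n. power_moment M j * power_moment N (n - j))
      = \<beta> * power_moment M (n + 1) - \<alpha> * power_moment M (n + 2)"
    by simp
  moreover have S_nonneg: "0 \<le> (\<Sum>j\<le>n. power_moment M j * power_moment N (n - j))"
    using M.power_moment_nonneg N.power_moment_nonneg by (intro sum_nonneg) auto
  ultimately have "\<bar>\<kappa>\<bar> * (\<Sum>j\<le>n. power_moment M j * power_moment N (n - j))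
      = \<bar>\<beta> * power_moment M (n + 1) - \<alpha> * power_moment M (n + 2)\<bar>"
    by (metis abs_mult abs_of_nonneg)
  also have "\<dots> \<le> \<bar>\<beta> * power_moment M (n + 1)\<bar> + \<bar>\<alpha> * power_moment M (n + 2)\<bar>"
    by (rule abs_triangle_ineq4)
  also have "\<dots> = \<bar>\<alpha>\<bar> * power_moment M (n + 2) + \<bar>\<beta>\<bar> * power_moment M (n + 1)"
    using M.power_moment_nonneg by (simp add: abs_mult)
  finally have "\<bar>\<kappa>\<bar> * (\<Sum>j\<le>n. power_moment M j * power_moment N (n - j)) \<le> \<dots>" .
  moreover have "power_moment M 0 * power_moment N (n - 0)
      \<le> (\<Sum>j\<le>n. power_moment M j * power_moment N (n - j))"
    using M.power_moment_nonneg N.power_moment_nonneg by (intro member_le_sum) auto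
  then have "\<bar>\<kappa>\<bar> * (power_moment M 0 * power_moment N n)
      \<le> \<bar>\<kappa>\<bar> * (\<Sum>j\<le>n. power_moment M j * power_moment N (n - j))"
    by (intro mult_left_mono) auto
  ultimately show ?thesis
    by (simp add: mult.assoc)
qed

section \<open>Reduction to the half line\<close>

text \<open>
  The complement of the support is a union of open null sets, and countably many of them
  suffice.
\<close>

lemma AE_in_supp:
  assumes "sets (cabs s) = sets borel"
  shows "AE x in cabs s. x \<in> supp s"
proof -
  define \<U> where "\<U> = {U. open U \<and> emeasure (cabs s) U = 0}"
  obtain \<V> where \<V>: "\<V> \<subseteq> \<U>" "countable \<V>" "\<Union>\<V> = \<Union>\<U>"
    using Lindelof[of \<U>] by (auto simp: \<U>_def)
  have "(\<Union>U\<in>\<V>. U) \<in> null_sets (cabs s)"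
    using \<V>(1,2) assms by (intro null_sets_UN') (auto simp: \<U>_def null_sets_def)
  then have "\<Union>\<V> \<in> null_sets (cabs s)"
    by simp
  moreover have "{x \<in> space (cabs s). x \<notin> supp s} \<subseteq> \<Union>\<V>"
    unfolding \<V>(3) by (auto simp: supp_def \<U>_def)
  ultimately show ?thesis
    by (rule AE_I')
qed

lemma supp_subset_Co: "s \<in> cs_measures \<Delta> \<Longrightarrow> supp s \<subseteq> \<Delta>"
  by (auto simp: cs_measures_def Co_supp_def hull_inc)

lemma cs_measuresD:
  assumes "s \<in> cs_measures \<Delta>"
  shows "sets (cabs s) = sets borel" "finite_measure (cabs s)" "\<bar>csign s\<bar> = 1"
    "infinite (supp s)" "convex \<Delta>" "infinite \<Delta>"
  using assms supp_subset_Co[OF assms]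
  by (auto simp: cs_measures_def Co_supp_def finite_subset)

text \<open>
  Finiteness of the moments is part of the class only for unbounded supports; on a bounded
  support powers are bounded almost everywhere.
\<close>

lemma cs_measures_integrable_power:
  assumes "s \<in> cs_measures \<Delta>"
  shows "integrable (cabs s) (\<lambda>x. x ^ n)"
proof (cases "bounded (supp s)")
  case True
  interpret finite_measure "cabs s"
    using assms by (rule cs_measuresD)
  note sets_eq [measurable_cong] = cs_measuresD(1)[OF assms]
  from True obtain B where B: "\<And>x. x \<in> supp s \<Longrightarrow> \<bar>x\<bar> \<le> B"
    by (auto simp: bounded_iff)
  have "AE x in cabs s. norm (x ^ n) \<le> B ^ n"
    using AE_in_supp[OF sets_eq]
    by eventually_elim (auto simp: power_abs intro!: power_mono B)
  then show ?thesis
    by (intro integrable_const_bound) auto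
next
  case False
  with assms show ?thesis
    by (auto simp: cs_measures_def)
qed

lemma half_line_measure_affine_image:
  assumes s: "s \<in> cs_measures \<Delta>" and "a \<noteq> 0" and nonneg: "\<And>x. x \<in> \<Delta> \<Longrightarrow> 0 \<le> a * x + b"
  shows "half_line_measure (distr (cabs s) borel (\<lambda>x. a * x + b))"
proof -
  interpret finite_measure "cabs s"
    using s by (rule cs_measuresD)
  note sets_eq [measurable_cong] = cs_measuresD(1)[OF s]
  let ?M = "distr (cabs s) borel (\<lambda>x. a * x + b)"
  have meas: "(\<lambda>x. a * x + b) \<in> measurable (cabs s) borel"
    by measurable
  have nonneg_supp: "0 \<le> a * x + b" if "x \<in> supp s" for x
    using nonneg supp_subset_Co[OF s] that by auto
  show ?thesis
  proof (intro half_line_measure.intro half_line_measure_axioms.intro)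
    show "finite_measure ?M"
      by (rule finite_measure_distr[OF meas])
    show "sets ?M = sets borel" by simp
    have "AE x in cabs s. 0 \<le> a * x + b"
      using AE_in_supp[OF sets_eq] by eventually_elim (rule nonneg_supp)
    then show "AE y in ?M. 0 \<le> y"
      by (subst AE_distr_iff[OF meas]) auto
    fix n
    have "integrable (cabs s) (\<lambda>x. (a * x + b) ^ n)"
      unfolding binomial_ring power_mult_distrib
      by (intro Bochner_Integration.integrable_sum integrable_mult_left integrable_mult_right
            cs_measures_integrable_power[OF s])
    then show "integrable ?M (\<lambda>y. y ^ n)"
      by (subst integrable_distr_eq[OF meas]) auto
  next
    \<comment> \<open>An infinite support has a point other than the preimage \<open>- b / a\<close> of \<open>0\<close>.\<close>
    have "\<not> supp s \<subseteq> {- b / a}"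
      using cs_measuresD(4)[OF s] finite_subset by blast
    then obtain x where x: "x \<in> supp s" "x \<noteq> - b / a"
      by auto
    define r where "r = (a * x + b) / 2"
    have "a * x + b \<noteq> 0"
      using x(2) \<open>a \<noteq> 0\<close> by (auto simp: field_simps)
    with nonneg_supp[OF x(1)] have "0 < r"
      by (simp add: r_def)
    define U where "U = {x. r < a * x + b}"
    have "open U"
      unfolding U_def by (intro open_Collect_less continuous_intros)
    moreover have "x \<in> U"
      using \<open>0 < r\<close> by (simp add: U_def r_def)
    ultimately have "emeasure (cabs s) U \<noteq> 0"
      using x(1) by (auto simp: supp_def)
    then have "0 < measure (cabs s) U"
      by (simp add: emeasure_eq_measure less_le)
    also have "\<dots> \<le> measure (cabs s) ((\<lambda>x. a * x + b) -` {r..} \<inter> space (cabs s))"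
    proof (rule finite_measure_mono)
      show "U \<subseteq> (\<lambda>x. a * x + b) -` {r..} \<inter> space (cabs s)"
        using sets_eq_imp_space_eq[OF sets_eq] by (auto simp: U_def)
    qed (use meas in measurable)
    also have "\<dots> = measure ?M {r..}"
      by (rule measure_distr[OF meas, symmetric]) simp
    finally show "\<exists>r>0. 0 < measure ?M {r..}"
      using \<open>0 < r\<close> by blast
  qed
qed

lemma carleman_series_affine_image_iff:
  assumes s: "s \<in> cs_measures \<Delta>" and "a \<noteq> 0" and nonneg: "\<And>x. x \<in> \<Delta> \<Longrightarrow> 0 \<le> a * x + b"
  shows "carleman_series_diverges (affine_image a b s) \<longleftrightarrow>
    carleman_sum_diverges (distr (cabs s) borel (\<lambda>x. a * x + b))"
proof -
  interpret half_line_measure "distr (cabs s) borel (\<lambda>x. a * x + b)"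
    using assms by (rule half_line_measure_affine_image)
  have "\<bar>moment (affine_image a b s) n\<bar>
      = power_moment (distr (cabs s) borel (\<lambda>x. a * x + b)) n" for n
    using cs_measuresD(3)[OF s] power_moment_nonneg[of n]
    by (simp add: moment_def cs_integral_def affine_image_def power_moment_def abs_mult)
  then show ?thesis
    by (simp add: carleman_series_diverges_def carleman_sum_diverges_def)
qed

section \<open>The measure of a Nikishin system\<close>

text \<open>
  The interiors are disjoint, because a nonempty open set is infinite, so that a hyperplane
  separates them. As infinite convex sets, \<open>S\<close> and \<open>T\<close> lie in the closures of their interiors.
\<close>

lemma convex_real_almost_disjoint_separated:
  fixes S T :: "real set"
  assumes "convex S" "convex T" "infinite S" "infinite T" and fin: "finite (S \<inter> T)"
  obtains p where "(\<forall>x\<in>S. \<forall>y\<in>T. x \<le> p \<and> p \<le> y) \<or> (\<forall>x\<in>S. \<forall>y\<in>T. y \<le> p \<and> p \<le> x)"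
proof -
  have interior: "interior A \<noteq> {}" if A: "convex A" "infinite A" for A :: "real set"
  proof -
    obtain x where x: "x \<in> A"
      using A(2) by fastforce
    have "\<not> A \<subseteq> {x}"
      using A(2) finite_subset by blast
    then obtain y where "y \<in> A" "y \<noteq> x"
      by auto
    with x obtain u v where uv: "u \<in> A" "v \<in> A" "u < v"
      by (metis linorder_neqE_linordered_idom)
    have "{u..v} \<subseteq> A"
      using A(1) uv convex_contains_segment[of A]
      by (auto simp: closed_segment_eq_real_ivl split: if_splits)
    then have "{u<..<v} \<subseteq> interior A"
      by (intro interior_maximal) auto
    moreover have "(u + v) / 2 \<in> {u<..<v}"
      using uv by simp
    ultimately show ?thesis by blast
  qed
  have "interior S \<inter> interior T = {}"
  proof (rule ccontr)
    assume "interior S \<inter> interior T \<noteq> {}"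
    then have "infinite (interior S \<inter> interior T)"
      by (meson finite_imp_not_open open_Int open_interior)
    with fin show False
      by (meson Int_mono finite_subset interior_subset)
  qed
  then obtain c d where "c \<noteq> 0"
    and S: "\<forall>x\<in>interior S. c \<bullet> x \<le> d" and T: "\<forall>y\<in>interior T. d \<le> c \<bullet> y"
    using separating_hyperplane_sets[of "interior S" "interior T"] assms(1-4) interior
    by (metis convex_interior)
  have closure: "A \<subseteq> closure (interior A)" if "convex A" "infinite A" for A :: "real set"
    using convex_closure_interior[OF that(1) interior[OF that]] closure_subset by blast
  have "closure (interior S) \<subseteq> {x. c * x \<le> d}"
    using S by (intro closure_minimal closed_Collect_le continuous_intros) auto
  with closure[of S] assms have S': "\<forall>x\<in>S. c * x \<le> d"
    by auto
  have "closure (interior T) \<subseteq> {x. d \<le> c * x}"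
    using T by (intro closure_minimal closed_Collect_le continuous_intros) auto
  with closure[of T] assms have T': "\<forall>y\<in>T. d \<le> c * y"
    by auto
  show thesis
  proof (rule that[of "d / c"])
    show "(\<forall>x\<in>S. \<forall>y\<in>T. x \<le> d / c \<and> d / c \<le> y) \<or> (\<forall>x\<in>S. \<forall>y\<in>T. y \<le> d / c \<and> d / c \<le> x)"
      using S' T' \<open>c \<noteq> 0\<close>
      by (cases "c > 0") (auto simp: field_simps mult.commute)
  qed
qed

lemma cauchy_transform_bound_off_support:
  fixes x :: real
  assumes s: "s \<in> cs_measures \<Delta>" and far: "\<And>y. y \<in> \<Delta> \<Longrightarrow> 1 \<le> \<bar>x - y\<bar>"
  shows "\<bar>cauchy_transform s x\<bar> \<le> measure (cabs s) (space (cabs s))"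
proof -
  interpret finite_measure "cabs s"
    using s by (rule cs_measuresD)
  have "\<bar>cauchy_transform s x\<bar> = \<bar>LINT y|cabs s. 1 / (x - y)\<bar>"
    using cs_measuresD(3)[OF s] by (simp add: cauchy_transform_def cs_integral_def abs_mult)
  also have "\<dots> \<le> (LINT y|cabs s. \<bar>1 / (x - y)\<bar>)"
    by (rule integral_abs_bound)
  also have "\<dots> \<le> (LINT y|cabs s. 1)"
  proof (rule integral_mono_AE')
    show "AE y in cabs s. \<bar>1 / (x - y)\<bar> \<le> 1"
      using AE_in_supp[OF cs_measuresD(1)[OF s]]
    proof eventually_elim
      case (elim y)
      then have "1 \<le> \<bar>x - y\<bar>"
        using far supp_subset_Co[OF s] by auto
      then show ?case
        by (simp add: abs_divide divide_le_eq)
    qed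
  qed auto
  finally show ?thesis by simp
qed

text \<open>
  The bracket is defined only through its values on Borel sets; this domination by a density is
  what turns them into bounds for integrals.
\<close>

lemma bracket_le_density:
  assumes \<sigma>1: "\<sigma>1 \<in> cs_measures \<Delta>" and s: "s \<in> cs_measures \<Delta>'"
    and int: "integrable (cabs \<sigma>1) (cauchy_transform \<sigma>2)"
    and br: "is_bracket \<sigma>1 \<sigma>2 s"
  shows "cabs s \<le> density (cabs \<sigma>1) (\<lambda>x. ennreal \<bar>cauchy_transform \<sigma>2 x\<bar>)"
proof -
  interpret s: finite_measure "cabs s"
    using s by (rule cs_measuresD)
  note sets_eq [measurable_cong] = cs_measuresD(1)[OF \<sigma>1]
  have meas [measurable]: "cauchy_transform \<sigma>2 \<in> borel_measurable (cabs \<sigma>1)"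
    using int by (rule borel_measurable_integrable)
  let ?N = "density (cabs \<sigma>1) (\<lambda>x. ennreal \<bar>cauchy_transform \<sigma>2 x\<bar>)"
  show ?thesis
  proof (subst le_measure)
    show "sets (cabs s) = sets ?N"
      using cs_measuresD(1)[OF s] sets_eq by simp
    show "\<forall>A\<in>sets (cabs s). emeasure (cabs s) A \<le> emeasure ?N A"
    proof
      fix A assume "A \<in> sets (cabs s)"
      then have A: "A \<in> sets borel" "A \<in> sets (cabs \<sigma>1)"
        using cs_measuresD(1)[OF s] sets_eq by auto
      have int_A: "integrable (cabs \<sigma>1) (\<lambda>x. indicator A x * \<bar>cauchy_transform \<sigma>2 x\<bar>)"
        using integrable_mult_indicator[OF A(2) integrable_abs[OF int]] by simp
      have "measure (cabs s) A = \<bar>cs_value s A\<bar>"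
        using cs_measuresD(3)[OF s] by (simp add: cs_value_def abs_mult)
      also have "\<dots> = \<bar>LINT x|cabs \<sigma>1. indicator A x * cauchy_transform \<sigma>2 x\<bar>"
        using br A(1) cs_measuresD(3)[OF \<sigma>1]
        by (simp add: is_bracket_def cs_integral_def abs_mult)
      also have "\<dots> \<le> (LINT x|cabs \<sigma>1. indicator A x * \<bar>cauchy_transform \<sigma>2 x\<bar>)"
        using integral_abs_bound[of "cabs \<sigma>1" "\<lambda>x. indicator A x * cauchy_transform \<sigma>2 x"]
        by (simp add: abs_mult)
      finally have "emeasure (cabs s) A
          \<le> ennreal (LINT x|cabs \<sigma>1. indicator A x * \<bar>cauchy_transform \<sigma>2 x\<bar>)"
        by (simp add: s.emeasure_eq_measure ennreal_leI)
      also have "\<dots> = (\<integral>\<^sup>+x. ennreal (indicator A x * \<bar>cauchy_transform \<sigma>2 x\<bar>) \<partial>cabs \<sigma>1)"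
        using int_A by (intro nn_integral_eq_integral[symmetric]) auto
      also have "\<dots> = emeasure ?N A"
        using A(2) by (subst emeasure_density)
          (auto intro!: nn_integral_cong simp: indicator_def)
      finally show "emeasure (cabs s) A \<le> emeasure ?N A" .
    qed
  qed
qed

lemma bracket_moment_bound:
  assumes nik: "nikishin \<Delta>1 \<Delta>2 \<sigma>1 \<sigma>2 (s11, s12)"
    and a: "a \<noteq> 0" and nonneg: "\<And>x. x \<in> \<Delta>1 \<Longrightarrow> 0 \<le> a * x + b"
  obtains K B where "0 \<le> K" "0 \<le> B"
    "\<And>n. power_moment (distr (cabs s12) borel (\<lambda>x. a * x + b)) n
        \<le> K * (B ^ n + power_moment (distr (cabs \<sigma>1) borel (\<lambda>x. a * x + b)) n)"
proof -
  have \<sigma>1: "\<sigma>1 \<in> cs_measures \<Delta>1" and \<sigma>2: "\<sigma>2 \<in> cs_measures \<Delta>2"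
    and s12: "s12 \<in> cs_measures \<Delta>1" and br: "is_bracket \<sigma>1 \<sigma>2 s12"
    and int: "integrable (cabs \<sigma>1) (cauchy_transform \<sigma>2)"
    and fin: "finite (\<Delta>1 \<inter> \<Delta>2)"
    using nik by (auto simp: nikishin_def)
  interpret M: half_line_measure "distr (cabs \<sigma>1) borel (\<lambda>x. a * x + b)"
    using \<sigma>1 a nonneg by (rule half_line_measure_affine_image)
  note sets_\<sigma>1 [measurable_cong] = cs_measuresD(1)[OF \<sigma>1]
  note sets_s12 [measurable_cong] = cs_measuresD(1)[OF s12]
  obtain p where p: "(\<forall>x\<in>\<Delta>1. \<forall>y\<in>\<Delta>2. x \<le> p \<and> p \<le> y) \<or> (\<forall>x\<in>\<Delta>1. \<forall>y\<in>\<Delta>2. y \<le> p \<and> p \<le> x)"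
    using convex_real_almost_disjoint_separated[of \<Delta>1 \<Delta>2] fin
      cs_measuresD(5,6)[OF \<sigma>1] cs_measuresD(5,6)[OF \<sigma>2] by blast
  let ?h = "cauchy_transform \<sigma>2 :: real \<Rightarrow> real"
  define V where "V = measure (cabs \<sigma>2) (space (cabs \<sigma>2))"
  define J where "J = (LINT x|cabs \<sigma>1. \<bar>?h x\<bar>)"
  define B where "B = \<bar>a\<bar> * (\<bar>p\<bar> + 1) + \<bar>b\<bar>"
  have V: "0 \<le> V" and J: "0 \<le> J" and B: "0 \<le> B"
    by (simp_all add: V_def J_def B_def)
  \<comment> \<open>\<open>B\<close> bounds \<open>a * x + b\<close> at distance less than \<open>1\<close> from \<open>p\<close>. Any other \<open>x\<close> in
    \<open>\<Delta>1\<close> has distance at least \<open>1\<close> from all of \<open>\<Delta>2\<close>, since \<open>p\<close> lies in between.\<close>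
  have pointwise: "(a * x + b) ^ n * \<bar>?h x\<bar> \<le> V * (a * x + b) ^ n + B ^ n * \<bar>?h x\<bar>"
    if x: "x \<in> \<Delta>1" for x n
  proof (cases "\<bar>x - p\<bar> < 1")
    case True
    have "a * x + b \<le> \<bar>a\<bar> * \<bar>x\<bar> + \<bar>b\<bar>"
      by (metis abs_ge_self abs_mult add_mono)
    also have "\<dots> \<le> B"
      unfolding B_def using True by (intro add_mono mult_left_mono) auto
    finally have "(a * x + b) ^ n * \<bar>?h x\<bar> \<le> B ^ n * \<bar>?h x\<bar>"
      using nonneg[OF x] by (intro mult_right_mono power_mono) auto
    then show ?thesis
      using V nonneg[OF x] by (simp add: add_increasing)
  next
    case False
    have "\<bar>?h x\<bar> \<le> V"
      unfolding V_def
    proof (rule cauchy_transform_bound_off_support[OF \<sigma>2])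
      fix y assume "y \<in> \<Delta>2"
      with p x False show "1 \<le> \<bar>x - y\<bar>" by fastforce
    qed
    then have "(a * x + b) ^ n * \<bar>?h x\<bar> \<le> (a * x + b) ^ n * V"
      using nonneg[OF x] by (intro mult_left_mono) auto
    then show ?thesis
      using B by (simp add: mult.commute add_increasing2)
  qed
  have bound: "power_moment (distr (cabs s12) borel (\<lambda>x. a * x + b)) n
      \<le> (V + J) * (B ^ n + power_moment (distr (cabs \<sigma>1) borel (\<lambda>x. a * x + b)) n)" for n
  proof -
    have mom: "power_moment (distr (cabs s) borel (\<lambda>x. a * x + b)) n
        = (LINT x|cabs s. (a * x + b) ^ n)"
      if "sets (cabs s) = sets borel" for s
      unfolding power_moment_def using that
      by (subst integral_distr) (auto cong: measurable_cong_sets)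
    have int_pow: "integrable (cabs s) (\<lambda>x. (a * x + b) ^ n)"
      if "s \<in> cs_measures \<Delta>1" for s
    proof -
      interpret half_line_measure "distr (cabs s) borel (\<lambda>x. a * x + b)"
        using that a nonneg by (rule half_line_measure_affine_image)
      note [measurable_cong] = cs_measuresD(1)[OF that]
      show ?thesis
        using integrable_power[of n] by (subst (asm) integrable_distr_eq) auto
    qed
    have AE_\<Delta>1: "AE x in cabs s. x \<in> \<Delta>1" if "s \<in> cs_measures \<Delta>1" for s
      using AE_in_supp[OF cs_measuresD(1)[OF that]] supp_subset_Co[OF that]
      by (auto elim!: eventually_mono)
    have int_rhs: "integrable (cabs \<sigma>1) (\<lambda>x. V * (a * x + b) ^ n + B ^ n * \<bar>?h x\<bar>)"
      using int_pow[OF \<sigma>1] int by auto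
    have "ennreal (LINT x|cabs s12. (a * x + b) ^ n)
        = (\<integral>\<^sup>+x. ennreal ((a * x + b) ^ n) \<partial>cabs s12)"
      using int_pow[OF s12] AE_\<Delta>1[OF s12] nonneg
      by (intro nn_integral_eq_integral[symmetric]) (auto elim!: eventually_mono)
    also have "\<dots> \<le> (\<integral>\<^sup>+x. ennreal ((a * x + b) ^ n)
        \<partial>density (cabs \<sigma>1) (\<lambda>x. ennreal \<bar>?h x\<bar>))"
      using sets_s12 sets_\<sigma>1
      by (intro nn_integral_mono_measure bracket_le_density[OF \<sigma>1 s12 int br]) auto
    also have "\<dots> = (\<integral>\<^sup>+x. ennreal \<bar>?h x\<bar> * ennreal ((a * x + b) ^ n) \<partial>cabs \<sigma>1)"
      using borel_measurable_integrable[OF int] by (intro nn_integral_density) auto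
    also have "\<dots> \<le> (\<integral>\<^sup>+x. ennreal (V * (a * x + b) ^ n + B ^ n * \<bar>?h x\<bar>) \<partial>cabs \<sigma>1)"
    proof (rule nn_integral_mono_AE)
      show "AE x in cabs \<sigma>1. ennreal \<bar>?h x\<bar> * ennreal ((a * x + b) ^ n)
          \<le> ennreal (V * (a * x + b) ^ n + B ^ n * \<bar>?h x\<bar>)"
        using AE_\<Delta>1[OF \<sigma>1]
      proof eventually_elim
        case (elim x)
        then show ?case
          using pointwise[of x n] nonneg[of x]
          by (simp add: ennreal_mult[symmetric] mult.commute ennreal_leI)
      qed
    qed
    also have "\<dots> = ennreal (LINT x|cabs \<sigma>1. V * (a * x + b) ^ n + B ^ n * \<bar>?h x\<bar>)"
      using int_rhs AE_\<Delta>1[OF \<sigma>1] nonneg V B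
      by (intro nn_integral_eq_integral) (auto elim!: eventually_mono)
    also have "(LINT x|cabs \<sigma>1. V * (a * x + b) ^ n + B ^ n * \<bar>?h x\<bar>)
        = V * (LINT x|cabs \<sigma>1. (a * x + b) ^ n) + B ^ n * J"
      unfolding J_def using int_pow[OF \<sigma>1] int by (subst Bochner_Integration.integral_add) auto
    also have "\<dots> = V * power_moment (distr (cabs \<sigma>1) borel (\<lambda>x. a * x + b)) n + B ^ n * J"
      by (simp add: mom sets_\<sigma>1)
    finally have "power_moment (distr (cabs s12) borel (\<lambda>x. a * x + b)) n
        \<le> V * power_moment (distr (cabs \<sigma>1) borel (\<lambda>x. a * x + b)) n + B ^ n * J"
      using V J B M.power_moment_nonneg[of n]
      by (subst (asm) ennreal_le_iff) (auto simp: mom sets_s12)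
    also have "\<dots> \<le> (V + J) * (B ^ n + power_moment (distr (cabs \<sigma>1) borel (\<lambda>x. a * x + b)) n)"
      using V J B M.power_moment_nonneg[of n] by (simp add: algebra_simps)
    finally show ?thesis .
  qed
  show thesis
    using V J by (intro that[of "V + J" B] bound B) simp
qed

section \<open>The inverse measure\<close>

lemma cauchy_transform_of_real:
  "cauchy_transform s (complex_of_real x) = complex_of_real (cauchy_transform s x)"
proof -
  have "(\<lambda>y. 1 / (complex_of_real x - complex_of_real y)) = (\<lambda>y. complex_of_real (1 / (x - y)))"
    by simp
  then show ?thesis
    by (simp add: cauchy_transform_def cs_integral_def scaleR_conv_of_real
        del: of_real_divide of_real_diff)
qed

text \<open>
  The evaluation point is the preimage of \<open>- 1 / s\<close>: as \<open>s\<close> decreases to \<open>0\<close>, the image runs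
  along the negative half line to infinity.
\<close>

lemma cauchy_transform_eq_stieltjes_series:
  assumes "sets (cabs \<sigma>) = sets borel" and "a \<noteq> 0" and "s > 0"
  shows "cauchy_transform \<sigma> ((- 1 / s - b) / a)
    = - (csign \<sigma> * a * s * stieltjes_series (distr (cabs \<sigma>) borel (\<lambda>x. a * x + b)) s)"
proof -
  note [measurable_cong] = assms(1)
  have "1 / ((- 1 / s - b) / a - y) = - (a * s) * (1 / (1 + s * (a * y + b)))" for y
  proof -
    have "(- 1 / s - b) / a - y = - ((1 + s * (a * y + b)) / (a * s))"
      using assms by (simp add: field_simps)
    then show ?thesis
      by simp
  qed
  then have "cauchy_transform \<sigma> ((- 1 / s - b) / a)
      = csign \<sigma> * (LINT y|cabs \<sigma>. - (a * s) * (1 / (1 + s * (a * y + b))))"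
    by (simp add: cauchy_transform_def cs_integral_def)
  also have "\<dots> = - (csign \<sigma> * a * s * (LINT y|cabs \<sigma>. 1 / (1 + s * (a * y + b))))"
    by (subst integral_mult_right_zero) simp
  also have "(LINT y|cabs \<sigma>. 1 / (1 + s * (a * y + b)))
      = stieltjes_series (distr (cabs \<sigma>) borel (\<lambda>x. a * x + b)) s"
    unfolding stieltjes_series_def by (subst integral_distr) auto
  finally show ?thesis .
qed

text \<open>
  In the variable \<open>s\<close>, the equation that defines the inverse measure states that the transform
  of \<open>\<sigma>\<close> is the reciprocal of an affine function plus \<open>\<kappa> * s\<^sup>2\<close> times the transform of
  \<open>\<tau>\<close>. The shift by \<open>2\<close> in the moments comes from this factor \<open>s\<^sup>2\<close>.
\<close>

lemma inverse_measure_moment_bound: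
  assumes inv: "is_inverse_measure \<Delta> \<sigma> \<tau>"
    and a: "a \<noteq> 0" and nonneg: "\<And>x. x \<in> \<Delta> \<Longrightarrow> 0 \<le> a * x + b"
  obtains K where "0 \<le> K"
    "\<And>n. power_moment (distr (cabs \<tau>) borel (\<lambda>x. a * x + b)) n
        \<le> K * (1 + power_moment (distr (cabs \<sigma>) borel (\<lambda>x. a * x + b)) (n + 2))"
proof -
  obtain \<Delta>' l where \<sigma>: "\<sigma> \<in> cs_measures \<Delta>" and \<tau>: "\<tau> \<in> cs_measures \<Delta>'" "\<Delta>' \<subseteq> \<Delta>"
    and l: "degree l = 1"
    and recip: "\<And>z::complex. z \<notin> of_real ` \<Delta> \<Longrightarrow>
      1 / cauchy_transform \<sigma> z = poly (map_poly of_real l) z + cauchy_transform \<tau> z"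
    using inv by (auto simp: is_inverse_measure_def)
  let ?M = "distr (cabs \<sigma>) borel (\<lambda>x. a * x + b)"
  let ?N = "distr (cabs \<tau>) borel (\<lambda>x. a * x + b)"
  interpret M: half_line_measure ?M
    using \<sigma> a nonneg by (rule half_line_measure_affine_image)
  interpret N: half_line_measure ?N
    using \<tau> a nonneg by (intro half_line_measure_affine_image) auto
  obtain l0 l1 where l_eq: "l = [:l0, l1:]"
    using l by (metis degree1_coeffs)
  define \<epsilon> where "\<epsilon> = csign \<sigma>"
  define \<eta> where "\<eta> = csign \<tau>"
  have sign: "\<bar>\<epsilon>\<bar> = 1" "\<bar>\<eta>\<bar> = 1"
    using cs_measuresD(3)[OF \<sigma>] cs_measuresD(3)[OF \<tau>(1)] by (auto simp: \<epsilon>_def \<eta>_def)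
  define \<alpha> where "\<alpha> = \<epsilon> * l1"
  define \<beta> where "\<beta> = - \<epsilon> * (a * l0 - b * l1)"
  define \<kappa> where "\<kappa> = \<epsilon> * \<eta> * a\<^sup>2"
  have "\<kappa> \<noteq> 0"
    using sign a by (auto simp: \<kappa>_def)
  have "stieltjes_series ?M s * (\<alpha> + \<beta> * s + \<kappa> * s\<^sup>2 * stieltjes_series ?N s) = 1"
    if s: "0 < s" for s
  proof -
    define x where "x = (- 1 / s - b) / a"
    have "a * x + b < 0"
      using s a by (simp add: x_def)
    then have "complex_of_real x \<notin> of_real ` \<Delta>"
      using nonneg by force
    from recip[OF this] have "complex_of_real (1 / cauchy_transform \<sigma> x)
        = complex_of_real (l0 + l1 * x + cauchy_transform \<tau> x)"
      by (simp add: cauchy_transform_of_real l_eq map_poly_pCons mult.commute)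
    then have "1 / cauchy_transform \<sigma> x = l0 + l1 * x + cauchy_transform \<tau> x"
      by (simp only: of_real_eq_iff)
    moreover have "cauchy_transform \<sigma> x = - (\<epsilon> * a * s * stieltjes_series ?M s)"
      unfolding x_def \<epsilon>_def
      by (rule cauchy_transform_eq_stieltjes_series[OF cs_measuresD(1)[OF \<sigma>] a s])
    moreover have "cauchy_transform \<tau> x = - (\<eta> * a * s * stieltjes_series ?N s)"
      unfolding x_def \<eta>_def
      by (rule cauchy_transform_eq_stieltjes_series[OF cs_measuresD(1)[OF \<tau>(1)] a s])
    moreover have "- (\<epsilon> * a * s * stieltjes_series ?M s) \<noteq> 0"
      using M.stieltjes_series_pos[of s] sign a s by auto
    moreover have "1 = u * (p - v)" if "1 / U = p + V" "U = u" "V = - v" "u \<noteq> 0" for p u v U V :: real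
      using that by (simp add: divide_eq_eq mult.commute)
    ultimately have "1 = - (\<epsilon> * a * s * stieltjes_series ?M s)
        * (l0 + l1 * x - \<eta> * a * s * stieltjes_series ?N s)"
      by blast
    also have "\<dots> = - (\<epsilon> * stieltjes_series ?M s)
        * (a * s * l0 + l1 * (a * s * x) - \<eta> * a\<^sup>2 * s\<^sup>2 * stieltjes_series ?N s)"
      by (simp add: algebra_simps power2_eq_square)
    also have "a * s * x = - 1 - b * s"
      using s a by (simp add: x_def field_simps)
    finally show ?thesis
      by (simp add: \<alpha>_def \<beta>_def \<kappa>_def algebra_simps)
  qed
  then have bound: "\<bar>\<kappa>\<bar> * power_moment ?M 0 * power_moment ?N n
      \<le> \<bar>\<alpha>\<bar> * power_moment ?M (n + 2) + \<bar>\<beta>\<bar> * power_moment ?M (n + 1)" for n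
    by (intro stieltjes_reciprocal_moment_bound M.half_line_measure_axioms
          N.half_line_measure_axioms) auto
  define c0 where "c0 = power_moment ?M 0"
  define A where "A = \<bar>\<alpha>\<bar> + \<bar>\<beta>\<bar> * (1 + c0)"
  have c0: "0 < c0"
    unfolding c0_def by (rule M.power_moment_pos)
  have "power_moment ?N n \<le> A / (\<bar>\<kappa>\<bar> * c0) * (1 + power_moment ?M (n + 2))" for n
  proof -
    let ?c = "power_moment ?M (n + 2)"
    have c: "0 \<le> ?c"
      by (rule M.power_moment_nonneg)
    have "\<bar>\<beta>\<bar> * power_moment ?M (n + 1) \<le> \<bar>\<beta>\<bar> * (c0 + ?c)"
      unfolding c0_def using M.power_moment_Suc_le[of n] by (intro mult_left_mono) auto
    also have "\<dots> \<le> \<bar>\<beta>\<bar> * ((1 + c0) * (1 + ?c))"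
      using c c0 by (intro mult_left_mono) (auto simp: algebra_simps)
    finally have "\<bar>\<kappa>\<bar> * c0 * power_moment ?N n \<le> \<bar>\<alpha>\<bar> * ?c + \<bar>\<beta>\<bar> * ((1 + c0) * (1 + ?c))"
      using bound[of n] unfolding c0_def by linarith
    also have "\<dots> \<le> \<bar>\<alpha>\<bar> * (1 + ?c) + \<bar>\<beta>\<bar> * ((1 + c0) * (1 + ?c))"
      using c0 by (intro add_mono mult_left_mono) auto
    also have "\<dots> = A * (1 + ?c)"
      by (simp add: A_def algebra_simps)
    finally show ?thesis
      using c0 \<open>\<kappa> \<noteq> 0\<close> by (simp add: pos_le_divide_eq mult.commute)
  qed
  with c0 show thesis
    by (intro that[of "A / (\<bar>\<kappa>\<bar> * c0)"]) (auto simp: A_def)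
qed

section \<open>Carleman's condition for the bracket and the inverse measure\<close>

theorem theorem1p5:
  fixes \<Delta>1 \<Delta>2 :: "real set"
    and \<sigma>1 \<sigma>2 s11 s12 :: cs_measure
  assumes "nikishin \<Delta>1 \<Delta>2 \<sigma>1 \<sigma>2 (s11, s12)"
    and "carleman \<sigma>1"
  shows "carleman s12 \<and> (\<forall>\<tau>1. is_inverse_measure \<Delta>1 \<sigma>1 \<tau>1 \<longrightarrow> carleman \<tau>1)"
proof -
  have \<sigma>1: "\<sigma>1 \<in> cs_measures \<Delta>1" and s12: "s12 \<in> cs_measures \<Delta>1"
    using assms(1) by (auto simp: nikishin_def)
  obtain a b where a: "a \<noteq> 0" and image: "(\<lambda>x. a * x + b) ` Co_supp \<sigma>1 \<subseteq> {0..}"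
    and div: "carleman_series_diverges (affine_image a b \<sigma>1)"
    using assms(2) by (auto simp: carleman_def)
  have nonneg: "0 \<le> a * x + b" if "x \<in> \<Delta>1" for x
    using image that \<sigma>1 by (auto simp: cs_measures_def)
  have M: "half_line_measure (distr (cabs \<sigma>1) borel (\<lambda>x. a * x + b))"
    using \<sigma>1 a nonneg by (rule half_line_measure_affine_image)
  have divM: "carleman_sum_diverges (distr (cabs \<sigma>1) borel (\<lambda>x. a * x + b))"
    using div carleman_series_affine_image_iff[OF \<sigma>1 a nonneg] by simp
  have carlemanI: "carleman s"
    if s: "s \<in> cs_measures \<Delta>" "\<Delta> \<subseteq> \<Delta>1" and KB: "0 \<le> K" "0 \<le> B"
      and bound: "\<And>n. power_moment (distr (cabs s) borel (\<lambda>x. a * x + b)) n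
        \<le> K * (B ^ n + power_moment (distr (cabs \<sigma>1) borel (\<lambda>x. a * x + b)) (n + k))"
    for s \<Delta> K B k
  proof -
    have nonneg': "0 \<le> a * x + b" if "x \<in> \<Delta>" for x
      using nonneg s(2) that by auto
    have "carleman_sum_diverges (distr (cabs s) borel (\<lambda>x. a * x + b))"
      using half_line_measure_affine_image[OF s(1) a nonneg'] KB bound
      by (intro carleman_sum_diverges_transfer[OF M _ divM])
    then have "carleman_series_diverges (affine_image a b s)"
      using carleman_series_affine_image_iff[OF s(1) a nonneg'] by simp
    moreover have "Co_supp s = \<Delta>"
      using s(1) by (simp add: cs_measures_def)
    ultimately show ?thesis
      using a nonneg' unfolding carleman_def by blast
  qed
  have "carleman s12"
  proof -
    obtain K B where "0 \<le> K" "0 \<le> B"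
      "\<And>n. power_moment (distr (cabs s12) borel (\<lambda>x. a * x + b)) n
        \<le> K * (B ^ n + power_moment (distr (cabs \<sigma>1) borel (\<lambda>x. a * x + b)) n)"
      using bracket_moment_bound[OF assms(1) a nonneg] by blast
    then show ?thesis
      by (intro carlemanI[OF s12, of K B 0]) auto
  qed
  moreover have "carleman \<tau>" if inv: "is_inverse_measure \<Delta>1 \<sigma>1 \<tau>" for \<tau>
  proof -
    obtain \<Delta>' where \<tau>: "\<tau> \<in> cs_measures \<Delta>'" "\<Delta>' \<subseteq> \<Delta>1"
      using inv by (auto simp: is_inverse_measure_def)
    obtain K where K: "0 \<le> K"
      "\<And>n. power_moment (distr (cabs \<tau>) borel (\<lambda>x. a * x + b)) n
        \<le> K * (1 + power_moment (distr (cabs \<sigma>1) borel (\<lambda>x. a * x + b)) (n + 2))"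
      using inverse_measure_moment_bound[OF inv a nonneg] by blast
    show ?thesis
      using K(2) by (intro carlemanI[OF \<tau> K(1), of 1 2]) auto
  qed
  ultimately show ?thesis by blast
qed

end
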